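(* Let $K$ be a field of characteristic zero, let $n\ge 2$, and let $L_n$ be the free metabelian Leibniz algebra over $K$ on $x_1,\ldots,x_n$. If $s\in L_n$ is a symmetric polynomial, then it is of the form \begin{align*} s=&\sum_{1\leq i\leq n}\alpha x_i+\sum_{1\leq i\leq n}[x_i,x_i]((1i)f)+\sum_{3\leq i\neq j\leq n}[x_i,x_j]((1i)(2j)g)\\ &+[x_1,x_2]g+\sum_{3\leq i\leq n}\bigl([x_1,x_i]((2i)g)+[x_i,x_2]((1i)g)\bigr)\\ &+[x_2,x_1]h+\sum_{3\leq i\leq n}\bigl([x_i,x_1]((2i)h)+[x_2,x_i]((1i)h)\bigr), \end{align*} where $\alpha\in K$ and $f,g,h\in K[R_n]=K[r_1,\ldots,r_n]$ are such that $\pi f=f$ for all $\pi\in\Pi_1$, $\sigma g=g$ for all $\sigma\in\Pi_{12}$, and $h=(12)g$.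
   Context: A Leibniz algebra over $K$ is a $K$-vector space with a bilinear bracket $[\cdot,\cdot]$ satisfying $[[x,y],z]=[[x,z],y]+[x,[y,z]]$ for all $x,y,z$. $L_n$ is the free algebra with free generators $X_n=\{x_1,\ldots,x_n\}$ in the variety of Leibniz algebras over $K$ satisfying the metabelian identity $[[x,y],[z,t]]=0$. $L_n'=[L_n,L_n]$ is its commutator ideal. $K[R_n]=K[r_1,\ldots,r_n]$ is the commutative polynomial algebra in $r_1,\ldots,r_n$, and $L_n'$ is a right $K[R_n]$-module via $u\,r_i=[u,x_i]$ for $u\in L_n'$ (these operators commute on $L_n'$ by the Leibniz and metabelian identities). The symmetric group $S_n$ acts on $L_n$ by algebra automorphisms with $\sigma x_i=x_{\sigma(i)}$, and on $K[R_n]$ by $\sigma f(r_1,\ldots,r_n)=f(r_{\sigma(1)},\ldots,r_{\sigma(n)})$. An element $s\in L_n$ is called symmetric if $\sigma s=s$ for all $\sigma\in S_n$. $\Pi_1=\{\pi\in S_n\mid \pi(1)=1\}$ and $\Pi_{12}=\{\pi\in S_n\mid \pi(1)=1,\ \pi(2)=2\}$. $(ab)\in S_n$ denotes a transposition, with the convention that $(11)$ is the identity permutation. *)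

theory Defs
  imports "HOL-Library.Poly_Mapping" "HOL-Combinatorics.Permutations" "HOL-Algebra.QuotRing"
    "HOL-Algebra.Module"
begin

section \<open>The free nonassociative algebra\<close>

text \<open>Nonassociative words in the generators, i.e. the free magma.\<close>

datatype (letters: 'x) word = Gen 'x | Br "'x word" "'x word"
  for map: map_word

text \<open>The generator \<open>x_i\<close> is \<open>Gen i\<close> for \<open>i \<in> {1..n}\<close>; elements of the free nonassociative
  algebra are finitely supported functions from words to the field.\<close>

type_synonym 'k nap = "nat word \<Rightarrow>\<^sub>0 'k"

definition na_bracket :: "'k::field nap \<Rightarrow> 'k nap \<Rightarrow> 'k nap" where
  "na_bracket p q =
    (\<Sum>u\<in>Poly_Mapping.keys p. \<Sum>v\<in>Poly_Mapping.keys q. Poly_Mapping.single (Br u v) (Poly_Mapping.lookup p u * Poly_Mapping.lookup q v))"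

definition na_scale :: "'k::field \<Rightarrow> 'k nap \<Rightarrow> 'k nap" where
  "na_scale c p = Poly_Mapping.map (\<lambda>b. c * b) p"

text \<open>Algebras are represented by the record type of modules, with \<open>\<otimes>\<close> as the
  bracket.  They have no unit, so the field \<open>one\<close> of the record carries no meaning.\<close>

definition free_na :: "nat \<Rightarrow> ('k::field, 'k nap) module" where
  "free_na n =
    \<lparr>carrier = {p. \<forall>w\<in>Poly_Mapping.keys p. letters w \<subseteq> {1..n}}, mult = na_bracket, one = undefined,
     zero = 0, add = (+), smult = na_scale\<rparr>"


section \<open>The free metabelian Leibniz algebra\<close>

text \<open>The two-sided ideal generated by all values of the two defining identities.\<close>

inductive_set met_leib_ideal :: "nat \<Rightarrow> 'k::field nap set" for n :: nat where
  leibniz: "\<lbrakk>x \<in> carrier (free_na n); y \<in> carrier (free_na n); z \<in> carrier (free_na n)\<rbrakk> \<Longrightarrow>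
    na_bracket (na_bracket x y) z
      - (na_bracket (na_bracket x z) y + na_bracket x (na_bracket y z)) \<in> met_leib_ideal n"
| metabelian: "\<lbrakk>x \<in> carrier (free_na n); y \<in> carrier (free_na n);
    z \<in> carrier (free_na n); t \<in> carrier (free_na n)\<rbrakk> \<Longrightarrow>
    na_bracket (na_bracket x y) (na_bracket z t) \<in> met_leib_ideal n"
| zero: "0 \<in> met_leib_ideal n"
| add: "\<lbrakk>p \<in> met_leib_ideal n; q \<in> met_leib_ideal n\<rbrakk> \<Longrightarrow> p + q \<in> met_leib_ideal n"
| scale: "p \<in> met_leib_ideal n \<Longrightarrow> na_scale c p \<in> met_leib_ideal n"
| bracket_right: "\<lbrakk>p \<in> met_leib_ideal n; q \<in> carrier (free_na n)\<rbrakk> \<Longrightarrow>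
    na_bracket p q \<in> met_leib_ideal n"
| bracket_left: "\<lbrakk>p \<in> met_leib_ideal n; q \<in> carrier (free_na n)\<rbrakk> \<Longrightarrow>
    na_bracket q p \<in> met_leib_ideal n"

text \<open>The quotient of \<^term>\<open>free_na n\<close> by this ideal.  It is \<^const>\<open>FactRing\<close> extended by
  the scalar multiplication (again up to the irrelevant field \<open>one\<close>).\<close>

definition L :: "nat \<Rightarrow> ('k::field, 'k nap set) module" where
  "L n =
    \<lparr>carrier = a_rcosets\<^bsub>free_na n\<^esub> (met_leib_ideal n),
     mult = rcoset_mult (free_na n) (met_leib_ideal n),
     one = undefined,
     zero = met_leib_ideal n,
     add = set_add (free_na n),
     smult = (\<lambda>c A. \<Union>a\<in>A. met_leib_ideal n +>\<^bsub>free_na n\<^esub> (c \<odot>\<^bsub>free_na n\<^esub> a))\<rparr>"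

definition gen :: "nat \<Rightarrow> nat \<Rightarrow> 'k::field nap set" where
  "gen n i = met_leib_ideal n +>\<^bsub>free_na n\<^esub> Poly_Mapping.single (Gen i) 1"

abbreviation gen_bracket :: "nat \<Rightarrow> nat \<Rightarrow> nat \<Rightarrow> 'k::field nap set" where
  "gen_bracket n i j \<equiv> gen n i \<otimes>\<^bsub>L n\<^esub> gen n j"


section \<open>Polynomials and their action on the commutator ideal\<close>

text \<open>Commutative polynomials in \<open>r_0, r_1, \<dots>\<close>: the monomial \<open>\<Prod>i. r_i ^ m_i\<close> is the finitely
  supported function \<open>m\<close>.\<close>

type_synonym 'k mpoly = "(nat \<Rightarrow>\<^sub>0 nat) \<Rightarrow>\<^sub>0 'k"

definition var :: "nat \<Rightarrow> 'k::field mpoly" where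
  "var i = Poly_Mapping.single (Poly_Mapping.single i 1) 1"

definition poly_ring :: "nat \<Rightarrow> 'k::field mpoly set" where
  "poly_ring n = {f. \<forall>m\<in>Poly_Mapping.keys f. Poly_Mapping.keys m \<subseteq> {1..n}}"

text \<open>\<open>u\<cdot>r_1^{m_1}\<cdots>r_n^{m_n}\<close>, where \<open>u\<cdot>r_i = [u, x_i]\<close>.  On the commutator ideal the operators
  \<open>[_, x_i]\<close> commute, so that the order chosen here (first \<open>x_1\<close>, last \<open>x_n\<close>) does not matter;
  outside of it \<open>act_monom\<close> and \<open>act\<close> are not meant to be used.\<close>

definition act_monom :: "nat \<Rightarrow> 'k::field nap set \<Rightarrow> (nat \<Rightarrow>\<^sub>0 nat) \<Rightarrow> 'k nap set" where
  "act_monom n u m = fold (\<lambda>i. (\<lambda>v. v \<otimes>\<^bsub>L n\<^esub> gen n i) ^^ Poly_Mapping.lookup m i) [1..<Suc n] u"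

definition act :: "'k::field nap set \<Rightarrow> nat \<Rightarrow> 'k mpoly \<Rightarrow> 'k nap set"
    (\<open>(_ \<bullet>\<^bsub>_\<^esub> _)\<close> [76, 0, 76] 75) where
  "u \<bullet>\<^bsub>n\<^esub> f = (\<Oplus>\<^bsub>L n\<^esub>m\<in>Poly_Mapping.keys f. Poly_Mapping.lookup f m \<odot>\<^bsub>L n\<^esub> act_monom n u m)"


section \<open>The symmetric group\<close>

text \<open>Permutations of \<open>{1..n}\<close> act on the free nonassociative algebra by \<open>x_i \<mapsto> x_{\<sigma>(i)}\<close>.  This
  preserves the ideal, so the action on the quotient is by taking images of cosets.\<close>

definition na_perm :: "(nat \<Rightarrow> nat) \<Rightarrow> 'k::field nap \<Rightarrow> 'k nap" where
  "na_perm \<sigma> p = (\<Sum>w\<in>Poly_Mapping.keys p. Poly_Mapping.single (map_word \<sigma> w) (Poly_Mapping.lookup p w))"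

definition L_perm :: "(nat \<Rightarrow> nat) \<Rightarrow> 'k::field nap set \<Rightarrow> 'k nap set" where
  "L_perm \<sigma> A = na_perm \<sigma> ` A"

definition symmetric :: "nat \<Rightarrow> 'k::field nap set \<Rightarrow> bool" where
  "symmetric n s \<longleftrightarrow> s \<in> carrier (L n) \<and> (\<forall>\<sigma>. \<sigma> permutes {1..n} \<longrightarrow> L_perm \<sigma> s = s)"

text \<open>\<open>\<sigma> f(r_1, \<dots>, r_n) = f(r_{\<sigma>(1)}, \<dots>, r_{\<sigma>(n)})\<close>\<close>

definition poly_perm :: "(nat \<Rightarrow> nat) \<Rightarrow> 'k::field mpoly \<Rightarrow> 'k mpoly" where
  "poly_perm \<sigma> f =
    (\<Sum>m\<in>Poly_Mapping.keys f. Poly_Mapping.single 0 (Poly_Mapping.lookup f m) * (\<Prod>i\<in>Poly_Mapping.keys m. var (\<sigma> i) ^ Poly_Mapping.lookup m i))"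

definition Pi1 :: "nat \<Rightarrow> (nat \<Rightarrow> nat) set" where
  "Pi1 n = {\<pi>. \<pi> permutes {1..n} \<and> \<pi> 1 = 1}"

definition Pi12 :: "nat \<Rightarrow> (nat \<Rightarrow> nat) set" where
  "Pi12 n = {\<pi>. \<pi> permutes {1..n} \<and> \<pi> 1 = 1 \<and> \<pi> 2 = 2}"

end

theory Submission
  imports Defs
begin

text \<open>
  Modulo the defining ideal every element can be written as
  \<open>p = \<Sum>i. a_i x_i + \<Sum>i j. [x_i, x_j] F_ij\<close> with polynomials \<open>F_ij\<close> (\<open>normal_form_exists\<close>).
  The Leibniz identity, read as \<open>[p, [a, b]] = [[p, a], b] - [[p, b], a]\<close>, rewrites
  every word of length at least two as a combination of left-normed words
  \<open>[\<dots>[[x_i, x_j], x_k], \<dots>]\<close>.  On products, multiplications by generators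
  commute, because \<open>[[u, x], y] - [[u, y], x] = [u, [x, y]]\<close> is zero for a product \<open>u\<close> in a
  metabelian algebra; so the letters after the first two form a commutative monomial
  (\<open>L_products_mult_commute\<close>, \<open>na_act_monom_Suc\<close>).

  A permutation \<open>\<sigma>\<close> takes \<open>[x_i, x_j] F\<close> to \<open>[x_{\<sigma>(i)}, x_{\<sigma>(j)}] (\<sigma> F)\<close> (\<open>na_perm_act\<close>).  If \<open>s\<close>
  is symmetric, all translates of a normal form of \<open>s / n!\<close> again represent \<open>s / n!\<close>, and
  their sum represents \<open>s\<close>.  Its coefficients
  \<open>G_ij = \<Sum>\<sigma>. \<sigma> F_{\<sigma>\<^sup>-\<^sup>1(i) \<sigma>\<^sup>-\<^sup>1(j)}\<close> satisfy \<open>\<tau> G_ij = G_{\<tau>(i) \<tau>(j)}\<close>, and its linear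
  coefficients are all equal (\<open>symmetric_normal_form_exists\<close>).  Characteristic zero enters
  through the division by \<open>n!\<close>.

  It remains to put \<open>f = G_11\<close>, \<open>g = G_12\<close> and \<open>h = G_21\<close>.  Equivariance makes \<open>f\<close> and \<open>g\<close> invariant
  under the stabilisers of \<open>1\<close> and of \<open>(1, 2)\<close>, and it expresses every other coefficient through
  them by any permutation that moves the indices to the right place.

  The work in the quotient is done on representatives: \<open>cls n p\<close> is the coset of \<open>p\<close>,
  \<open>na_act\<close> lifts the polynomial action, and \<open>na_cong n\<close> is congruence modulo the ideal.
\<close>

section \<open>Finitely supported functions\<close>

lemma sum_keys_superset:
  assumes "finite A" "Poly_Mapping.keys p \<subseteq> A" "\<And>k. F k 0 = 0"
  shows "(\<Sum>k\<in>Poly_Mapping.keys p. F k (Poly_Mapping.lookup p k))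
    = (\<Sum>k\<in>A. F k (Poly_Mapping.lookup p k))"
  using assms by (intro sum.mono_neutral_left) (auto simp: in_keys_iff)

text \<open>The bracket, the actions of permutations and the module action are all defined by sums over the
  support of their argument; their additivity comes from this lemma.\<close>

lemma sum_keys_add:
  assumes "\<And>k. F k 0 = 0" and "\<And>k a b. F k (a + b) = F k a + F k b"
  shows "(\<Sum>k\<in>Poly_Mapping.keys (p + q). F k (Poly_Mapping.lookup (p + q) k))
    = (\<Sum>k\<in>Poly_Mapping.keys p. F k (Poly_Mapping.lookup p k))
      + (\<Sum>k\<in>Poly_Mapping.keys q. F k (Poly_Mapping.lookup q k))"
proof -
  let ?A = "Poly_Mapping.keys p \<union> Poly_Mapping.keys q"
  have A: "(\<Sum>k\<in>Poly_Mapping.keys r. F k (Poly_Mapping.lookup r k))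
      = (\<Sum>k\<in>?A. F k (Poly_Mapping.lookup r k))" if "Poly_Mapping.keys r \<subseteq> ?A" for r
    using that assms(1) by (intro sum_keys_superset) auto
  show ?thesis
    using A[OF Poly_Mapping.keys_add] A[of p] A[of q]
    by (simp only: lookup_add assms(2) sum.distrib Un_upper1 Un_upper2)
qed

lemma sum_singles: "(\<Sum>k\<in>Poly_Mapping.keys p. Poly_Mapping.single k (Poly_Mapping.lookup p k)) = p"
proof (rule poly_mapping_eqI)
  fix k
  show "Poly_Mapping.lookup (\<Sum>k\<in>Poly_Mapping.keys p.
      Poly_Mapping.single k (Poly_Mapping.lookup p k)) k = Poly_Mapping.lookup p k"
    by (simp add: lookup_sum lookup_single when_def in_keys_iff)
qed

lemma sum_in_additive:
  assumes "(0::'a::comm_monoid_add) \<in> S" and "\<And>x y. x \<in> S \<Longrightarrow> y \<in> S \<Longrightarrow> x + y \<in> S"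
    and "\<And>i. i \<in> J \<Longrightarrow> f i \<in> S"
  shows "sum f J \<in> S"
  using assms(3) by (induction J rule: infinite_finite_induct) (auto intro: assms(1,2))

text \<open>Together with additivity, this reduces identities between linear operations to single words or
  monomials, where they can be computed.\<close>

lemma poly_mapping_additive_induct [case_names zero single add]:
  fixes p :: "'a \<Rightarrow>\<^sub>0 'b::comm_monoid_add"
  assumes "P 0" "\<And>k c. k \<in> Poly_Mapping.keys p \<Longrightarrow> P (Poly_Mapping.single k c)"
    and "\<And>p q. P p \<Longrightarrow> P q \<Longrightarrow> P (p + q)"
  shows "P p"
proof -
  have "(\<Sum>k\<in>Poly_Mapping.keys p. Poly_Mapping.single k (Poly_Mapping.lookup p k)) \<in> {p. P p}"
    by (rule sum_in_additive) (auto intro: assms)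
  then show ?thesis by (simp add: sum_singles)
qed

lemma additive_sum:
  fixes f :: "'a::comm_monoid_add \<Rightarrow> 'b::comm_monoid_add"
  assumes "f 0 = 0" and "\<And>x y. f (x + y) = f x + f y"
  shows "f (sum g J) = (\<Sum>i\<in>J. f (g i))"
  by (induction J rule: infinite_finite_induct) (auto simp: assms)

section \<open>Bilinearity of the operations on the free nonassociative algebra\<close>

lemma lookup_na_scale [simp]: "Poly_Mapping.lookup (na_scale c p) k = c * Poly_Mapping.lookup p k"
  by (simp add: na_scale_def Poly_Mapping.map.rep_eq when_def)

lemma na_scale_0 [simp]: "na_scale c 0 = 0"
  and na_scale_add: "na_scale c (p + q) = na_scale c p + na_scale c q"
  and na_scale_diff: "na_scale c (p - q) = na_scale c p - na_scale c q"
  and na_scale_add_left: "na_scale (c + d) p = na_scale c p + na_scale d p"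
  and na_scale_zero_left [simp]: "na_scale 0 p = 0"
  and na_scale_minus_one: "na_scale (- 1) p = - p"
  and na_scale_single: "na_scale c (Poly_Mapping.single k d) = Poly_Mapping.single k (c * d)"
  by (rule poly_mapping_eqI; simp add: lookup_add lookup_minus lookup_single when_def algebra_simps)+

lemma na_scale_sum_left: "na_scale (sum c J) p = (\<Sum>i\<in>J. na_scale (c i) p)"
  by (rule additive_sum) (auto simp: na_scale_add_left)

lemma keys_na_scale: "Poly_Mapping.keys (na_scale c p) \<subseteq> Poly_Mapping.keys p"
  by (auto simp: in_keys_iff)

lemma na_bracket_0 [simp]: "na_bracket 0 q = 0" "na_bracket p 0 = 0"
  by (simp_all add: na_bracket_def)

lemma na_bracket_add_left: "na_bracket (p + p') q = na_bracket p q + na_bracket p' q"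
  unfolding na_bracket_def
  by (rule sum_keys_add[where F = "\<lambda>u a. \<Sum>v\<in>Poly_Mapping.keys q.
        Poly_Mapping.single (Br u v) (a * Poly_Mapping.lookup q v)"])
    (auto simp: distrib_right single_add sum.distrib)

lemma na_bracket_add_right: "na_bracket p (q + q') = na_bracket p q + na_bracket p q'"
  unfolding na_bracket_def
  by (subst (1 2 3) sum.swap,
      rule sum_keys_add[where F = "\<lambda>v b. \<Sum>u\<in>Poly_Mapping.keys p.
        Poly_Mapping.single (Br u v) (Poly_Mapping.lookup p u * b)"])
    (auto simp: distrib_left single_add sum.distrib)

lemma na_bracket_diff_left: "na_bracket (p - p') q = na_bracket p q - na_bracket p' q"
  using na_bracket_add_left[of "p - p'" p' q] by simp

lemma na_bracket_diff_right: "na_bracket p (q - q') = na_bracket p q - na_bracket p q'"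
  using na_bracket_add_right[of p "q - q'" q'] by simp

lemma na_bracket_sum_left: "na_bracket (sum f J) q = (\<Sum>i\<in>J. na_bracket (f i) q)"
  by (rule additive_sum[where f = "\<lambda>p. na_bracket p q"]) (auto simp: na_bracket_add_left)

lemma na_bracket_single:
  "na_bracket (Poly_Mapping.single u a) (Poly_Mapping.single v b)
    = Poly_Mapping.single (Br u v) (a * b)"
  by (simp add: na_bracket_def keys_single)

lemma na_bracket_scale_left: "na_bracket (na_scale c p) q = na_scale c (na_bracket p q)"
proof (induction p rule: poly_mapping_additive_induct)
  case (single u a)
  show ?case
    by (induction q rule: poly_mapping_additive_induct)
      (simp_all add: na_bracket_add_right na_scale_add na_bracket_single na_scale_single mult.assoc)
qed (simp_all add: na_bracket_add_left na_scale_add)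

section \<open>The defining ideal and its cosets\<close>

abbreviation nonassoc :: "nat \<Rightarrow> 'k::field nap set" where
  "nonassoc n \<equiv> carrier (free_na n)"

abbreviation na_gen :: "nat \<Rightarrow> 'k::field nap" where
  "na_gen i \<equiv> Poly_Mapping.single (Gen i) 1"

lemma nonassoc_iff: "p \<in> nonassoc n \<longleftrightarrow> (\<forall>w\<in>Poly_Mapping.keys p. letters w \<subseteq> {1..n})"
  by (simp add: free_na_def)

lemma nonassoc_0 [simp]: "0 \<in> nonassoc n"
  by (simp add: nonassoc_iff)

lemma nonassoc_add [intro]: "p \<in> nonassoc n \<Longrightarrow> q \<in> nonassoc n \<Longrightarrow> p + q \<in> nonassoc n"
  using Poly_Mapping.keys_add[of p q] by (force simp: nonassoc_iff)

lemma nonassoc_scale [intro]: "p \<in> nonassoc n \<Longrightarrow> na_scale c p \<in> nonassoc n"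
  using keys_na_scale[of c p] by (force simp: nonassoc_iff)

lemma nonassoc_diff [intro]: "p \<in> nonassoc n \<Longrightarrow> q \<in> nonassoc n \<Longrightarrow> p - q \<in> nonassoc n"
  using nonassoc_add[of p n "na_scale (-1) q"] nonassoc_scale[of q n "-1"]
  by (simp add: na_scale_minus_one)

lemma nonassoc_sum: "(\<And>i. i \<in> J \<Longrightarrow> f i \<in> nonassoc n) \<Longrightarrow> sum f J \<in> nonassoc n"
  by (rule sum_in_additive) auto

lemma nonassoc_single: "letters w \<subseteq> {1..n} \<Longrightarrow> Poly_Mapping.single w c \<in> nonassoc n"
  by (simp add: nonassoc_iff)

lemma nonassoc_gen [intro]: "i \<in> {1..n} \<Longrightarrow> na_gen i \<in> nonassoc n"
  by (intro nonassoc_single) auto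

lemma nonassoc_bracket [intro]:
  assumes "p \<in> nonassoc n" "q \<in> nonassoc n"
  shows "na_bracket p q \<in> nonassoc n"
  unfolding na_bracket_def
proof (intro nonassoc_sum)
  fix u v assume "u \<in> Poly_Mapping.keys p" "v \<in> Poly_Mapping.keys q"
  then have "letters (Br u v) \<subseteq> {1..n}" using assms by (auto simp: nonassoc_iff)
  then show "Poly_Mapping.single (Br u v) (Poly_Mapping.lookup p u * Poly_Mapping.lookup q v)
      \<in> nonassoc n"
    by (rule nonassoc_single)
qed

lemma ideal_subset: "p \<in> met_leib_ideal n \<Longrightarrow> p \<in> nonassoc n"
  by (induction rule: met_leib_ideal.induct) (intro nonassoc_bracket nonassoc_add nonassoc_diff
      nonassoc_scale nonassoc_0 | assumption)+

lemma ideal_minus: "p \<in> met_leib_ideal n \<Longrightarrow> - p \<in> met_leib_ideal n"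
  using met_leib_ideal.scale[of p n "-1"] by (simp add: na_scale_minus_one)

lemma ideal_diff: "p \<in> met_leib_ideal n \<Longrightarrow> q \<in> met_leib_ideal n \<Longrightarrow> p - q \<in> met_leib_ideal n"
  using met_leib_ideal.add[OF _ ideal_minus, of p n q] by simp

lemma ideal_sum: "(\<And>i. i \<in> J \<Longrightarrow> f i \<in> met_leib_ideal n) \<Longrightarrow> sum f J \<in> met_leib_ideal n"
  by (rule sum_in_additive) (auto intro: met_leib_ideal.zero met_leib_ideal.add)

abbreviation na_cong :: "nat \<Rightarrow> 'k::field nap \<Rightarrow> 'k nap \<Rightarrow> bool" where
  "na_cong n p q \<equiv> p - q \<in> met_leib_ideal n"

lemma na_cong_refl: "na_cong n p p"
  by (simp add: met_leib_ideal.zero)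

lemma na_cong_sym: "na_cong n p q \<Longrightarrow> na_cong n q p"
  using ideal_minus[of "p - q" n] by simp

lemma na_cong_trans: "na_cong n p q \<Longrightarrow> na_cong n q r \<Longrightarrow> na_cong n p r"
  using met_leib_ideal.add[of "p - q" n "q - r"] by simp

lemma na_cong_add: "na_cong n p q \<Longrightarrow> na_cong n p' q' \<Longrightarrow> na_cong n (p + p') (q + q')"
  using met_leib_ideal.add[of "p - q" n "p' - q'"] by (simp add: algebra_simps)

lemma na_cong_diff: "na_cong n p q \<Longrightarrow> na_cong n p' q' \<Longrightarrow> na_cong n (p - p') (q - q')"
  using ideal_diff[of "p - q" n "p' - q'"] by (simp add: algebra_simps)

lemma na_cong_sum: "(\<And>i. i \<in> J \<Longrightarrow> na_cong n (f i) (g i)) \<Longrightarrow> na_cong n (sum f J) (sum g J)"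
  using ideal_sum[of J "\<lambda>i. f i - g i" n] by (simp add: sum_subtractf)

lemma na_cong_scale: "na_cong n p q \<Longrightarrow> na_cong n (na_scale c p) (na_scale c q)"
  using met_leib_ideal.scale[of "p - q" n c] by (simp add: na_scale_diff)

text \<open>The bracket is well defined on cosets.  The difference is split as
  \<open>[p - p', q] + [p', q - q']\<close>, and as the ideal absorbs only factors from the algebra on
  \<open>x_1, \<dots>, x_n\<close>, the factors kept outside must lie there.\<close>

lemma na_cong_bracket:
  assumes "na_cong n p p'" "na_cong n q q'" "p' \<in> nonassoc n" "q \<in> nonassoc n"
  shows "na_cong n (na_bracket p q) (na_bracket p' q')"
proof -
  have "na_bracket p q - na_bracket p' q' = na_bracket (p - p') q + na_bracket p' (q - q')"
    by (simp add: na_bracket_diff_left na_bracket_diff_right)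
  then show ?thesis
    by (metis assms met_leib_ideal.add met_leib_ideal.bracket_left met_leib_ideal.bracket_right)
qed

text \<open>The canonical projection onto \<open>L n\<close>.  The lemmas below turn every operation of the quotient,
  as encoded by unions of cosets, into an operation on representatives, so that
  the rest of the argument is a calculation with congruences.\<close>

definition cls :: "nat \<Rightarrow> 'k::field nap \<Rightarrow> 'k nap set" where
  "cls n p = met_leib_ideal n +>\<^bsub>free_na n\<^esub> p"

lemma mem_cls_iff: "q \<in> cls n p \<longleftrightarrow> na_cong n q p"
proof
  assume "na_cong n q p"
  then show "q \<in> cls n p"
    unfolding cls_def a_r_coset_def' by (auto simp: free_na_def intro!: bexI[of _ "q - p"])
qed (auto simp: cls_def a_r_coset_def' free_na_def)

lemma self_mem_cls: "p \<in> cls n p"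
  unfolding mem_cls_iff by (rule na_cong_refl)

lemma cls_eq_iff: "cls n p = cls n q \<longleftrightarrow> na_cong n p q"
proof
  assume "cls n p = cls n q"
  then show "na_cong n p q" using self_mem_cls[of p n] by (simp add: mem_cls_iff)
next
  assume *: "na_cong n p q"
  have "na_cong n x p \<longleftrightarrow> na_cong n x q" for x
    using na_cong_trans[OF _ *, of x] na_cong_trans[OF _ na_cong_sym[OF *], of x] by blast
  then show "cls n p = cls n q" by (auto simp: mem_cls_iff)
qed

lemma carrier_L: "carrier (L n) = cls n ` nonassoc n"
  by (auto simp: L_def A_RCOSETS_def' cls_def)

lemma cls_in_L [intro]: "p \<in> nonassoc n \<Longrightarrow> cls n p \<in> carrier (L n)"
  by (simp add: carrier_L)

lemma gen_eq_cls: "gen n i = cls n (na_gen i)"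
  by (simp add: gen_def cls_def)

lemma L_add_cls: "cls n p \<oplus>\<^bsub>L n\<^esub> cls n q = cls n (p + q)"
proof -
  have "x \<in> cls n p <+>\<^bsub>free_na n\<^esub> cls n q" if "na_cong n x (p + q)" for x
  proof -
    have "x - p \<in> cls n q" using that by (simp add: mem_cls_iff algebra_simps)
    moreover have "x = p \<oplus>\<^bsub>free_na n\<^esub> (x - p)" by (simp add: free_na_def)
    ultimately show ?thesis
      using self_mem_cls[of p n] unfolding set_add_def' by blast
  qed
  moreover have "na_cong n x (p + q)" if "x \<in> cls n p <+>\<^bsub>free_na n\<^esub> cls n q" for x
    using that na_cong_add unfolding set_add_def' by (fastforce simp: free_na_def mem_cls_iff)
  ultimately show ?thesis by (auto simp: L_def mem_cls_iff)
qed

lemma L_zero_cls: "\<zero>\<^bsub>L n\<^esub> = cls n 0"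
  by (auto simp: L_def mem_cls_iff)

lemma L_mult_cls:
  assumes "p \<in> nonassoc n" "q \<in> nonassoc n"
  shows "cls n p \<otimes>\<^bsub>L n\<^esub> cls n q = cls n (na_bracket p q)"
proof -
  have "met_leib_ideal n +>\<^bsub>free_na n\<^esub> (a \<otimes>\<^bsub>free_na n\<^esub> b) = cls n (na_bracket p q)"
    if "a \<in> cls n p" "b \<in> cls n q" for a b
  proof -
    have "b \<in> nonassoc n"
      using that(2) assms(2) nonassoc_add[of "b - q" n q] ideal_subset by (auto simp: mem_cls_iff)
    then have "cls n (na_bracket a b) = cls n (na_bracket p q)"
      using that assms by (simp add: cls_eq_iff na_cong_bracket mem_cls_iff)
    then show ?thesis by (simp add: cls_def free_na_def)
  qed
  then have "cls n p \<otimes>\<^bsub>L n\<^esub> cls n q = (\<Union>a\<in>cls n p. \<Union>b\<in>cls n q. cls n (na_bracket p q))"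
    by (simp add: L_def rcoset_mult_def)
  then show ?thesis
    using self_mem_cls by blast
qed

lemma L_smult_cls: "c \<odot>\<^bsub>L n\<^esub> cls n p = cls n (na_scale c p)"
proof -
  have "met_leib_ideal n +>\<^bsub>free_na n\<^esub> (c \<odot>\<^bsub>free_na n\<^esub> a) = cls n (na_scale c p)"
    if "a \<in> cls n p" for a
  proof -
    have "cls n (na_scale c a) = cls n (na_scale c p)"
      using that by (simp add: cls_eq_iff na_cong_scale mem_cls_iff)
    then show ?thesis by (simp add: cls_def free_na_def)
  qed
  then have "c \<odot>\<^bsub>L n\<^esub> cls n p = (\<Union>a\<in>cls n p. cls n (na_scale c p))"
    by (simp add: L_def)
  then show ?thesis
    using self_mem_cls by blast
qed

lemma L_abelian_monoid: "abelian_monoid (L n)"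
  by (rule abelian_monoidI)
    (auto simp: carrier_L L_add_cls L_zero_cls algebra_simps)

lemma L_finsum_cls:
  assumes "finite J" "\<And>i. i \<in> J \<Longrightarrow> t i = cls n (p i)" "\<And>i. i \<in> J \<Longrightarrow> p i \<in> nonassoc n"
  shows "(\<Oplus>\<^bsub>L n\<^esub>i\<in>J. t i) = cls n (\<Sum>i\<in>J. p i)"
proof -
  interpret abelian_monoid "L n" by (rule L_abelian_monoid)
  show ?thesis
    using assms
  proof (induction J rule: finite_induct)
    case (insert x F)
    then have "t \<in> F \<rightarrow> carrier (L n)" "t x \<in> carrier (L n)"
      by (metis Pi_I cls_in_L insertCI)+
    then show ?case using insert by (simp add: L_add_cls)
  qed (simp add: L_zero_cls)
qed

section \<open>Permuting variables in polynomials\<close>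

text \<open>The action of \<open>\<sigma>\<close> on exponent vectors: the exponent of \<open>r_i\<close> moves to \<open>r_{\<sigma>(i)}\<close>.
  In these terms \<^const>\<open>poly_perm\<close> is the linear extension of a map of monomials.\<close>

definition mono_perm :: "(nat \<Rightarrow> nat) \<Rightarrow> (nat \<Rightarrow>\<^sub>0 nat) \<Rightarrow> (nat \<Rightarrow>\<^sub>0 nat)" where
  "mono_perm \<sigma> m = (\<Sum>i\<in>Poly_Mapping.keys m. Poly_Mapping.single (\<sigma> i) (Poly_Mapping.lookup m i))"

lemma mono_perm_0 [simp]: "mono_perm \<sigma> 0 = 0"
  by (simp add: mono_perm_def)

lemma mono_perm_add: "mono_perm \<sigma> (m + m') = mono_perm \<sigma> m + mono_perm \<sigma> m'"
  unfolding mono_perm_def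
  by (rule sum_keys_add[where F = "\<lambda>i. Poly_Mapping.single (\<sigma> i)"]) (auto simp: single_add)

lemma mono_perm_single: "mono_perm \<sigma> (Poly_Mapping.single i c) = Poly_Mapping.single (\<sigma> i) c"
  by (simp add: mono_perm_def)

lemma mono_perm_comp: "mono_perm \<sigma> (mono_perm \<tau> m) = mono_perm (\<sigma> \<circ> \<tau>) m"
  by (induction m rule: poly_mapping_additive_induct) (simp_all add: mono_perm_add mono_perm_single)

lemma keys_mono_perm: "Poly_Mapping.keys (mono_perm \<sigma> m) \<subseteq> \<sigma> ` Poly_Mapping.keys m"
  unfolding mono_perm_def by (rule order_trans[OF keys_sum]) (auto split: if_splits)

lemma var_power: "var i ^ k = Poly_Mapping.single (Poly_Mapping.single i k) 1"
  by (induction k) (simp_all add: var_def mult_single flip: single_add)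

lemma prod_single_one:
  "(\<Prod>i\<in>J. Poly_Mapping.single (a i) (1::'k::field)) = Poly_Mapping.single (\<Sum>i\<in>J. a i) 1"
  by (induction J rule: infinite_finite_induct) (simp_all add: mult_single)

lemma poly_perm_eq: "poly_perm \<sigma> f
    = (\<Sum>m\<in>Poly_Mapping.keys f. Poly_Mapping.single (mono_perm \<sigma> m) (Poly_Mapping.lookup f m))"
  by (simp add: poly_perm_def var_power prod_single_one mult_single mono_perm_def)

lemma poly_perm_0 [simp]: "poly_perm \<sigma> 0 = 0"
  by (simp add: poly_perm_eq)

lemma poly_perm_add: "poly_perm \<sigma> (f + f') = poly_perm \<sigma> f + poly_perm \<sigma> f'"
  unfolding poly_perm_eq
  by (rule sum_keys_add[where F = "\<lambda>m. Poly_Mapping.single (mono_perm \<sigma> m)"])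
    (auto simp: single_add)

lemma poly_perm_sum: "poly_perm \<sigma> (sum f J) = (\<Sum>i\<in>J. poly_perm \<sigma> (f i))"
  by (rule additive_sum) (auto simp: poly_perm_add)

lemma poly_perm_single:
  "poly_perm \<sigma> (Poly_Mapping.single m c) = Poly_Mapping.single (mono_perm \<sigma> m) c"
  by (simp add: poly_perm_eq)

lemma poly_perm_comp: "poly_perm \<sigma> (poly_perm \<tau> f) = poly_perm (\<sigma> \<circ> \<tau>) f"
  by (induction f rule: poly_mapping_additive_induct)
    (simp_all only: poly_perm_0 poly_perm_add poly_perm_single mono_perm_comp)

lemma poly_ring_0 [simp]: "0 \<in> poly_ring n"
  by (simp add: poly_ring_def)

lemma poly_ring_add: "f \<in> poly_ring n \<Longrightarrow> g \<in> poly_ring n \<Longrightarrow> f + g \<in> poly_ring n"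
  using Poly_Mapping.keys_add[of f g] by (force simp: poly_ring_def)

lemma poly_ring_diff:
  "f \<in> poly_ring n \<Longrightarrow> g \<in> poly_ring n \<Longrightarrow> f - g \<in> poly_ring n"
  using keys_diff[of f g] by (force simp: poly_ring_def)

lemma poly_ring_sum: "(\<And>i. i \<in> J \<Longrightarrow> f i \<in> poly_ring n) \<Longrightarrow> sum f J \<in> poly_ring n"
  by (rule sum_in_additive) (auto intro: poly_ring_add)

lemma poly_ring_single: "Poly_Mapping.keys m \<subseteq> {1..n} \<Longrightarrow> Poly_Mapping.single m c \<in> poly_ring n"
  by (simp add: poly_ring_def)

lemma poly_ring_perm:
  assumes "\<sigma> permutes {1..n}" "f \<in> poly_ring n"
  shows "poly_perm \<sigma> f \<in> poly_ring n"
  unfolding poly_perm_eq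
proof (intro poly_ring_sum poly_ring_single)
  fix m assume "m \<in> Poly_Mapping.keys f"
  then have "Poly_Mapping.keys m \<subseteq> {1..n}" using assms(2) by (auto simp: poly_ring_def)
  then show "Poly_Mapping.keys (mono_perm \<sigma> m) \<subseteq> {1..n}"
    using keys_mono_perm[of \<sigma> m] permutes_image[OF assms(1)] by blast
qed

section \<open>Permuting generators in the free nonassociative algebra\<close>

lemma na_perm_0 [simp]: "na_perm \<sigma> 0 = 0"
  by (simp add: na_perm_def)

lemma na_perm_add: "na_perm \<sigma> (p + q) = na_perm \<sigma> p + na_perm \<sigma> q"
  unfolding na_perm_def
  by (rule sum_keys_add[where F = "\<lambda>w. Poly_Mapping.single (map_word \<sigma> w)"])
    (auto simp: single_add)

lemma na_perm_diff: "na_perm \<sigma> (p - q) = na_perm \<sigma> p - na_perm \<sigma> q"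
  using na_perm_add[of \<sigma> "p - q" q] by simp

lemma na_perm_sum: "na_perm \<sigma> (sum f J) = (\<Sum>i\<in>J. na_perm \<sigma> (f i))"
  by (rule additive_sum) (auto simp: na_perm_add)

lemma na_perm_single:
  "na_perm \<sigma> (Poly_Mapping.single w c) = Poly_Mapping.single (map_word \<sigma> w) c"
  by (simp add: na_perm_def)

lemma na_perm_scale: "na_perm \<sigma> (na_scale c p) = na_scale c (na_perm \<sigma> p)"
  by (induction p rule: poly_mapping_additive_induct)
    (simp_all add: na_scale_add na_perm_add na_perm_single na_scale_single)

lemma na_perm_bracket: "na_perm \<sigma> (na_bracket p q) = na_bracket (na_perm \<sigma> p) (na_perm \<sigma> q)"
proof (induction p rule: poly_mapping_additive_induct)
  case (single u a)
  show ?case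
    by (induction q rule: poly_mapping_additive_induct)
      (simp_all add: na_bracket_add_right na_perm_add na_bracket_single na_perm_single)
qed (simp_all add: na_bracket_add_left na_perm_add)

lemma nonassoc_perm:
  assumes "\<sigma> permutes {1..n}" "p \<in> nonassoc n"
  shows "na_perm \<sigma> p \<in> nonassoc n"
  unfolding na_perm_def
proof (intro nonassoc_sum nonassoc_single)
  fix w assume "w \<in> Poly_Mapping.keys p"
  then have "letters w \<subseteq> {1..n}" using assms(2) unfolding nonassoc_iff by blast
  then show "letters (map_word \<sigma> w) \<subseteq> {1..n}"
    using permutes_image[OF assms(1)] by (auto simp: word.set_map)
qed

text \<open>Values of the two identities go to values of the same identities, because \<open>\<sigma>\<close> acts by an
  endomorphism of the free nonassociative algebra.\<close>

lemma ideal_perm: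
  assumes "\<sigma> permutes {1..n}" "p \<in> met_leib_ideal n"
  shows "na_perm \<sigma> p \<in> met_leib_ideal n"
  using assms(2)
proof (induction rule: met_leib_ideal.induct)
  case (leibniz x y z)
  then show ?case
    unfolding na_perm_diff na_perm_add na_perm_bracket
    by (intro met_leib_ideal.leibniz nonassoc_perm[OF assms(1)])
next
  case (metabelian x y z t)
  then show ?case
    unfolding na_perm_bracket by (intro met_leib_ideal.metabelian nonassoc_perm[OF assms(1)])
next
  case (bracket_right p q)
  then show ?case
    unfolding na_perm_bracket by (intro met_leib_ideal.bracket_right nonassoc_perm[OF assms(1)])
next
  case (bracket_left p q)
  then show ?case
    unfolding na_perm_bracket by (intro met_leib_ideal.bracket_left nonassoc_perm[OF assms(1)])
qed (auto simp: na_perm_add na_perm_scale intro: met_leib_ideal.intros)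

lemma na_cong_perm:
  "\<sigma> permutes {1..n} \<Longrightarrow> na_cong n p q \<Longrightarrow> na_cong n (na_perm \<sigma> p) (na_perm \<sigma> q)"
  using ideal_perm[of \<sigma> n "p - q"] by (simp add: na_perm_diff)

section \<open>The module structure on the commutator ideal\<close>

lemma fold_funpow_closed:
  assumes "\<And>i v. i \<in> set xs \<Longrightarrow> v \<in> D \<Longrightarrow> R i v \<in> D" and "u \<in> D"
  shows "fold (\<lambda>i. R i ^^ m i) xs u \<in> D"
  using assms
proof (induction xs arbitrary: u)
  case (Cons x xs)
  have "(R x ^^ c) u \<in> D" for c
    using Cons.prems by (induction c) auto
  then show ?case using Cons by auto
qed simp

lemma fold_funpow_commute:
  assumes closed: "\<And>i v. i \<in> K \<Longrightarrow> v \<in> D \<Longrightarrow> R i v \<in> D"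
    and comm: "\<And>i j v. i \<in> K \<Longrightarrow> j \<in> K \<Longrightarrow> v \<in> D \<Longrightarrow> R i (R j v) = R j (R i v)"
    and "set xs \<subseteq> K" "k \<in> K" "u \<in> D"
  shows "fold (\<lambda>i. R i ^^ m i) xs (R k u) = R k (fold (\<lambda>i. R i ^^ m i) xs u)"
  using assms(3,5)
proof (induction xs arbitrary: u)
  case (Cons x xs)
  have D: "(R x ^^ c) u \<in> D" for c
    using Cons.prems closed by (induction c) auto
  have "(R x ^^ c) (R k u) = R k ((R x ^^ c) u)" for c
  proof (induction c)
    case (Suc c)
    then show ?case using comm[of x k, OF _ _ D] Cons.prems \<open>k \<in> K\<close> by simp
  qed simp
  then show ?case using Cons D by simp
qed simp

text \<open>If the operators \<open>R i\<close> commute on an invariant set \<open>D\<close>, then raising one exponent in a product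
  of powers applies one more operator: it can be moved through the later
  factors to the outermost position.\<close>

lemma fold_funpow_Suc:
  assumes closed: "\<And>i v. i \<in> K \<Longrightarrow> v \<in> D \<Longrightarrow> R i v \<in> D"
    and comm: "\<And>i j v. i \<in> K \<Longrightarrow> j \<in> K \<Longrightarrow> v \<in> D \<Longrightarrow> R i (R j v) = R j (R i v)"
    and "set xs \<subseteq> K" "distinct xs" "k \<in> set xs" "u \<in> D"
  shows "fold (\<lambda>i. R i ^^ (m(k := Suc (m k))) i) xs u = R k (fold (\<lambda>i. R i ^^ m i) xs u)"
  using assms(3-)
proof (induction xs arbitrary: u)
  case (Cons x xs)
  have D: "(R x ^^ c) u \<in> D" for c
    using Cons.prems closed by (induction c) auto
  show ?case
  proof (cases "x = k")
    case True
    then have "fold (\<lambda>i. R i ^^ (m(k := Suc (m k))) i) xs v = fold (\<lambda>i. R i ^^ m i) xs v" for v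
      using Cons.prems by (intro fold_cong) auto
    moreover have "fold (\<lambda>i. R i ^^ m i) xs (R k v) = R k (fold (\<lambda>i. R i ^^ m i) xs v)"
      if "v \<in> D" for v
      using Cons.prems that by (intro fold_funpow_commute[where K = K and D = D] closed comm) auto
    ultimately show ?thesis using True D by simp
  next
    case False
    then show ?thesis using Cons D by simp
  qed
qed simp

text \<open>The products of two elements.  The right multiplications by generators commute here, but not on all
  of \<open>L n\<close>; the linear span is the commutator ideal, but the products alone are
  already stable under right multiplication, which is all that the folding lemma asks for.\<close>

definition L_products :: "nat \<Rightarrow> 'k::field nap set set" where
  "L_products n = {cls n (na_bracket a b) |a b. a \<in> nonassoc n \<and> b \<in> nonassoc n}"

lemma L_products_mult_gen:
  assumes "u \<in> L_products n" "i \<in> {1..n}"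
  shows "u \<otimes>\<^bsub>L n\<^esub> gen n i \<in> L_products n"
proof -
  obtain a b where "u = cls n (na_bracket a b)" "a \<in> nonassoc n" "b \<in> nonassoc n"
    using assms(1) unfolding L_products_def by blast
  then have "u \<otimes>\<^bsub>L n\<^esub> gen n i = cls n (na_bracket (na_bracket a b) (na_gen i))"
      "na_bracket a b \<in> nonassoc n" "na_gen i \<in> (nonassoc n :: 'a nap set)"
    using assms(2) by (simp_all add: gen_eq_cls L_mult_cls nonassoc_gen nonassoc_bracket)
  then show ?thesis unfolding L_products_def by blast
qed

text \<open>By the Leibniz identity, \<open>[[u, x], y]\<close> and \<open>[[u, y], x]\<close> differ by \<open>[u, [x, y]]\<close>, which
  vanishes by the metabelian identity when \<open>u\<close> is a product.\<close>

lemma L_products_mult_commute: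
  assumes "u \<in> L_products n" "i \<in> {1..n}" "j \<in> {1..n}"
  shows "u \<otimes>\<^bsub>L n\<^esub> gen n i \<otimes>\<^bsub>L n\<^esub> gen n j = u \<otimes>\<^bsub>L n\<^esub> gen n j \<otimes>\<^bsub>L n\<^esub> gen n i"
proof -
  obtain a b where ab: "u = cls n (na_bracket a b)" "a \<in> nonassoc n" "b \<in> nonassoc n"
    using assms(1) unfolding L_products_def by blast
  let ?p = "na_bracket a b" and ?x = "na_gen i :: 'a nap" and ?y = "na_gen j :: 'a nap"
  have car: "?p \<in> nonassoc n" "?x \<in> nonassoc n" "?y \<in> nonassoc n"
    using ab assms by auto
  have "na_bracket (na_bracket ?p ?x) ?y
      - (na_bracket (na_bracket ?p ?y) ?x + na_bracket ?p (na_bracket ?x ?y)) \<in> met_leib_ideal n"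
    by (rule met_leib_ideal.leibniz[OF car])
  moreover have "na_bracket ?p (na_bracket ?x ?y) \<in> met_leib_ideal n"
    by (rule met_leib_ideal.metabelian[OF ab(2,3) car(2,3)])
  ultimately have "na_cong n (na_bracket (na_bracket ?p ?x) ?y) (na_bracket (na_bracket ?p ?y) ?x)"
    using met_leib_ideal.add by fastforce
  then show ?thesis
    using car by (simp add: ab(1) gen_eq_cls L_mult_cls nonassoc_bracket cls_eq_iff)
qed

lemma act_monom_Suc:
  assumes "u \<in> L_products n" "k \<in> {1..n}"
  shows "act_monom n u (m + Poly_Mapping.single k 1) = act_monom n u m \<otimes>\<^bsub>L n\<^esub> gen n k"
proof -
  have "Poly_Mapping.lookup (m + Poly_Mapping.single k 1)
      = (Poly_Mapping.lookup m)(k := Suc (Poly_Mapping.lookup m k))"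
    by (auto simp: lookup_add lookup_single when_def)
  then show ?thesis
    unfolding act_monom_def
    by (simp only:, intro fold_funpow_Suc[where K = "{1..n}" and D = "L_products n"
          and R = "\<lambda>i v. v \<otimes>\<^bsub>L n\<^esub> gen n i"] L_products_mult_gen L_products_mult_commute)
      (use assms in auto)
qed

text \<open>The formulas of \<^const>\<open>act_monom\<close> and \<^const>\<open>act\<close>, read in the free nonassociative
  algebra.  There the order of the factors matters; the module laws hold only up to congruence, and
  only on products.\<close>

definition na_act_monom :: "nat \<Rightarrow> 'k::field nap \<Rightarrow> (nat \<Rightarrow>\<^sub>0 nat) \<Rightarrow> 'k nap" where
  "na_act_monom n p m =
    fold (\<lambda>i. (\<lambda>q. na_bracket q (na_gen i)) ^^ Poly_Mapping.lookup m i) [1..<Suc n] p"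

definition na_act :: "nat \<Rightarrow> 'k::field nap \<Rightarrow> 'k mpoly \<Rightarrow> 'k nap" where
  "na_act n p f = (\<Sum>m\<in>Poly_Mapping.keys f. na_scale (Poly_Mapping.lookup f m) (na_act_monom n p m))"

lemma na_act_monom_0 [simp]: "na_act_monom n p 0 = p"
proof -
  have "fold (\<lambda>i. (R i ^^ 0)) xs p = p" for R :: "nat \<Rightarrow> 'a nap \<Rightarrow> 'a nap" and xs
    by (induction xs) auto
  then show ?thesis by (simp add: na_act_monom_def del: upt_Suc)
qed

lemma nonassoc_act_monom: "p \<in> nonassoc n \<Longrightarrow> na_act_monom n p m \<in> nonassoc n"
  unfolding na_act_monom_def
  by (rule fold_funpow_closed) (simp_all del: upt_Suc add: nonassoc_bracket nonassoc_gen)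

lemma nonassoc_act: "p \<in> nonassoc n \<Longrightarrow> na_act n p f \<in> nonassoc n"
  unfolding na_act_def by (intro nonassoc_sum nonassoc_scale nonassoc_act_monom)

lemma act_monom_cls:
  assumes "p \<in> nonassoc n"
  shows "act_monom n (cls n p) m = cls n (na_act_monom n p m)"
proof -
  have "fold (\<lambda>i. (\<lambda>v. v \<otimes>\<^bsub>L n\<^esub> gen n i) ^^ e i) xs (cls n p)
      = cls n (fold (\<lambda>i. (\<lambda>q. na_bracket q (na_gen i)) ^^ e i) xs p)"
    if "set xs \<subseteq> {1..n}" for e :: "nat \<Rightarrow> nat" and xs
    using that assms
  proof (induction xs arbitrary: p)
    case (Cons x xs)
    have "((\<lambda>v. v \<otimes>\<^bsub>L n\<^esub> gen n x) ^^ c) (cls n p)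
        = cls n (((\<lambda>q. na_bracket q (na_gen x)) ^^ c) p)
        \<and> ((\<lambda>q. na_bracket q (na_gen x)) ^^ c) p \<in> nonassoc n" for c
      using Cons.prems
      by (induction c) (simp_all add: gen_eq_cls L_mult_cls nonassoc_gen nonassoc_bracket)
    then show ?case using Cons by simp
  qed simp
  moreover have "set [1..<Suc n] \<subseteq> {1..n}" by auto
  ultimately show ?thesis unfolding act_monom_def na_act_monom_def by blast
qed

lemma act_cls:
  assumes "p \<in> nonassoc n"
  shows "cls n p \<bullet>\<^bsub>n\<^esub> f = cls n (na_act n p f)"
  unfolding act_def na_act_def
  by (rule L_finsum_cls)
    (auto simp only: act_monom_cls[OF assms] L_smult_cls finite_keys
      intro!: nonassoc_scale nonassoc_act_monom assms)

lemma na_act_monom_Suc: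
  assumes "a \<in> nonassoc n" "b \<in> nonassoc n" "k \<in> {1..n}"
  shows "na_cong n (na_act_monom n (na_bracket a b) (m + Poly_Mapping.single k 1))
    (na_bracket (na_act_monom n (na_bracket a b) m) (na_gen k))"
proof -
  have car: "na_bracket a b \<in> nonassoc n" using assms by auto
  have "cls n (na_bracket a b) \<in> L_products n" using assms unfolding L_products_def by blast
  from act_monom_Suc[OF this assms(3)] show ?thesis
    by (simp only: act_monom_cls[OF car] gen_eq_cls cls_eq_iff
        L_mult_cls[OF nonassoc_act_monom[OF car] nonassoc_gen[OF assms(3)]])
qed

lemma na_act_0 [simp]: "na_act n p 0 = 0"
  by (simp add: na_act_def)

lemma na_act_add: "na_act n p (f + g) = na_act n p f + na_act n p g"
  unfolding na_act_def
  by (rule sum_keys_add[where F = "\<lambda>m c. na_scale c (na_act_monom n p m)"])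
    (auto simp: na_scale_add_left)

lemma na_act_diff: "na_act n p (f - g) = na_act n p f - na_act n p g"
  using na_act_add[of n p "f - g" g] by simp

lemma na_act_sum: "na_act n p (sum f J) = (\<Sum>i\<in>J. na_act n p (f i))"
  by (rule additive_sum) (auto simp: na_act_add)

lemma na_act_single: "na_act n p (Poly_Mapping.single m c) = na_scale c (na_act_monom n p m)"
  by (simp add: na_act_def)

lemma monomial_induct [consumes 1, case_names zero step]:
  fixes m :: "'a \<Rightarrow>\<^sub>0 nat"
  assumes "Poly_Mapping.keys m \<subseteq> A" "P 0"
    and step: "\<And>m k. k \<in> A \<Longrightarrow> P m \<Longrightarrow> P (m + Poly_Mapping.single k 1)"
  shows "P m"
proof -
  have "\<forall>m0. P m0 \<longrightarrow> P (m0 + m)"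
  proof (induction m rule: poly_mapping_additive_induct)
    case (single k c)
    have "P (m0 + Poly_Mapping.single k c)" if "P m0" for m0
    proof (induction c)
      case (Suc c)
      have "k \<in> A" using single assms(1) by blast
      then show ?case
        using step[OF _ Suc, of k] by (simp add: add.assoc flip: single_add)
    qed (simp add: that)
    then show ?case by blast
  qed (auto simp flip: add.assoc)
  then show ?thesis using assms(2) by force
qed

text \<open>Permuting generators changes the order in which the multiplications are applied, so the two sides
  agree only modulo the ideal.  Building up \<open>m\<close> one variable at a time leaves this reordering to
  the commutation already contained in \<open>na_act_monom_Suc\<close>.\<close>

lemma na_perm_act_monom:
  assumes \<sigma>: "\<sigma> permutes {1..n}" and ab: "a \<in> nonassoc n" "b \<in> nonassoc n"
    and "Poly_Mapping.keys m \<subseteq> {1..n}"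
  shows "na_cong n (na_perm \<sigma> (na_act_monom n (na_bracket a b) m))
    (na_act_monom n (na_bracket (na_perm \<sigma> a) (na_perm \<sigma> b)) (mono_perm \<sigma> m))"
  using assms(4)
proof (induction m rule: monomial_induct)
  case zero
  then show ?case by (simp only: na_act_monom_0 mono_perm_0 na_perm_bracket na_cong_refl)
next
  case (step m k)
  let ?p = "na_bracket a b" and ?q = "na_bracket (na_perm \<sigma> a) (na_perm \<sigma> b)"
  have \<sigma>k: "\<sigma> k \<in> {1..n}" using \<sigma> step.hyps permutes_in_image by metis
  have \<sigma>ab: "na_perm \<sigma> a \<in> nonassoc n" "na_perm \<sigma> b \<in> nonassoc n"
    using nonassoc_perm[OF \<sigma>] ab by blast+
  have "na_perm \<sigma> (na_bracket (na_act_monom n ?p m) (na_gen k))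
      = na_bracket (na_perm \<sigma> (na_act_monom n ?p m)) (na_gen (\<sigma> k))"
    by (simp add: na_perm_bracket na_perm_single)
  then have "na_cong n (na_perm \<sigma> (na_act_monom n ?p (m + Poly_Mapping.single k 1)))
      (na_bracket (na_perm \<sigma> (na_act_monom n ?p m)) (na_gen (\<sigma> k)))"
    using na_cong_perm[OF \<sigma> na_act_monom_Suc[OF ab step.hyps, of m]] by (simp only:)
  moreover have "na_cong n (na_bracket (na_perm \<sigma> (na_act_monom n ?p m)) (na_gen (\<sigma> k)))
      (na_bracket (na_act_monom n ?q (mono_perm \<sigma> m)) (na_gen (\<sigma> k)))"
    by (intro na_cong_bracket step.IH na_cong_refl nonassoc_act_monom nonassoc_bracket \<sigma>ab
        nonassoc_gen \<sigma>k)
  moreover have "na_cong n (na_bracket (na_act_monom n ?q (mono_perm \<sigma> m)) (na_gen (\<sigma> k)))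
      (na_act_monom n ?q (mono_perm \<sigma> m + Poly_Mapping.single (\<sigma> k) 1))"
    by (rule na_cong_sym[OF na_act_monom_Suc[OF \<sigma>ab \<sigma>k]])
  ultimately show ?case
    unfolding mono_perm_add mono_perm_single by (blast intro: na_cong_trans)
qed

lemma na_perm_act:
  assumes "\<sigma> permutes {1..n}" "a \<in> nonassoc n" "b \<in> nonassoc n" "f \<in> poly_ring n"
  shows "na_cong n (na_perm \<sigma> (na_act n (na_bracket a b) f))
    (na_act n (na_bracket (na_perm \<sigma> a) (na_perm \<sigma> b)) (poly_perm \<sigma> f))"
proof (induction f rule: poly_mapping_additive_induct)
  case zero
  show ?case by (simp add: met_leib_ideal.zero)
next
  case (single m c)
  then have "Poly_Mapping.keys m \<subseteq> {1..n}" using assms(4) by (auto simp: poly_ring_def)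
  then show ?case
    unfolding na_act_single poly_perm_single na_perm_scale
    by (intro na_cong_scale na_perm_act_monom assms)
next
  case (add f g)
  then show ?case
    unfolding na_act_add poly_perm_add na_perm_add by (rule na_cong_add)
qed

section \<open>Brackets of two generators span the commutator ideal\<close>

definition bracket_comb :: "nat \<Rightarrow> (nat \<Rightarrow> nat \<Rightarrow> 'k::field mpoly) \<Rightarrow> 'k nap" where
  "bracket_comb n F =
    (\<Sum>i\<in>{1..n}. \<Sum>j\<in>{1..n}. na_act n (na_bracket (na_gen i) (na_gen j)) (F i j))"

definition bracket_span :: "nat \<Rightarrow> 'k::field nap set" where
  "bracket_span n = {p. \<exists>F. (\<forall>i j. F i j \<in> poly_ring n) \<and> na_cong n p (bracket_comb n F)}"

lemma nonassoc_bracket_comb: "bracket_comb n F \<in> nonassoc n"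
  unfolding bracket_comb_def
  by (intro nonassoc_sum nonassoc_act nonassoc_bracket nonassoc_gen)

lemma bracket_spanI:
  "(\<And>i j. F i j \<in> poly_ring n) \<Longrightarrow> na_cong n p (bracket_comb n F) \<Longrightarrow> p \<in> bracket_span n"
  unfolding bracket_span_def by blast

lemma bracket_span_cong: "na_cong n p q \<Longrightarrow> q \<in> bracket_span n \<Longrightarrow> p \<in> bracket_span n"
  unfolding bracket_span_def using na_cong_trans by blast

lemma bracket_span_0: "0 \<in> bracket_span n"
  unfolding bracket_span_def bracket_comb_def
  by (auto intro!: exI[of _ "\<lambda>i j. 0"] simp: met_leib_ideal.zero)

lemma bracket_span_add:
  assumes "p \<in> bracket_span n" "q \<in> bracket_span n"
  shows "p + q \<in> bracket_span n"
proof -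
  obtain F G where F: "\<And>i j. F i j \<in> poly_ring n" "na_cong n p (bracket_comb n F)"
    and G: "\<And>i j. G i j \<in> poly_ring n" "na_cong n q (bracket_comb n G)"
    using assms unfolding bracket_span_def by blast
  have "bracket_comb n F + bracket_comb n G = bracket_comb n (\<lambda>i j. F i j + G i j)"
    by (simp add: bracket_comb_def na_act_add sum.distrib)
  then show ?thesis
    using na_cong_add[OF F(2) G(2)] F(1) G(1)
    by (intro bracket_spanI[of "\<lambda>i j. F i j + G i j"] poly_ring_add) simp_all
qed

lemma bracket_span_diff:
  assumes "p \<in> bracket_span n" "q \<in> bracket_span n"
  shows "p - q \<in> bracket_span n"
proof -
  obtain F G where F: "\<And>i j. F i j \<in> poly_ring n" "na_cong n p (bracket_comb n F)"
    and G: "\<And>i j. G i j \<in> poly_ring n" "na_cong n q (bracket_comb n G)"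
    using assms unfolding bracket_span_def by blast
  have "bracket_comb n F - bracket_comb n G = bracket_comb n (\<lambda>i j. F i j - G i j)"
    by (simp add: bracket_comb_def na_act_diff sum_subtractf)
  then show ?thesis
    using na_cong_diff[OF F(2) G(2)] F(1) G(1)
    by (intro bracket_spanI[of "\<lambda>i j. F i j - G i j"] poly_ring_diff) simp_all
qed

lemma bracket_span_sum: "(\<And>i. i \<in> J \<Longrightarrow> f i \<in> bracket_span n) \<Longrightarrow> sum f J \<in> bracket_span n"
  by (rule sum_in_additive) (auto intro: bracket_span_0 bracket_span_add)

lemma na_act_in_bracket_span:
  assumes "i \<in> {1..n}" "j \<in> {1..n}" "f \<in> poly_ring n"
  shows "na_act n (na_bracket (na_gen i) (na_gen j)) f \<in> bracket_span n"
proof -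
  define F where "F = (\<lambda>i' j'. if i' = i then if j' = j then f else 0 else 0)"
  have "(\<Sum>j'\<in>{1..n}. na_act n (na_bracket (na_gen i') (na_gen j')) (F i' j'))
      = (if i' = i then na_act n (na_bracket (na_gen i) (na_gen j)) f else 0)" for i'
  proof (cases "i' = i")
    case True
    then have "na_act n (na_bracket (na_gen i') (na_gen j')) (F i' j')
        = (if j' = j then na_act n (na_bracket (na_gen i) (na_gen j)) f else 0)" for j'
      by (simp add: F_def)
    then show ?thesis using True assms(2) by simp
  qed (simp add: F_def)
  then have "bracket_comb n F = na_act n (na_bracket (na_gen i) (na_gen j)) f"
    using assms(1) by (simp add: bracket_comb_def)
  then show ?thesis
    using assms(3) by (intro bracket_spanI[of F]) (auto simp: F_def met_leib_ideal.zero)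
qed

lemma bracket_span_scale_bracket_gens:
  assumes "i \<in> {1..n}" "j \<in> {1..n}"
  shows "na_scale c (na_bracket (na_gen i) (na_gen j)) \<in> bracket_span n"
  using na_act_in_bracket_span[OF assms poly_ring_single[of 0 n c]] by (simp add: na_act_single)

text \<open>Multiplying by \<open>x_k\<close> multiplies each coefficient by \<open>r_k\<close>.\<close>

lemma bracket_span_bracket_gen:
  assumes "p \<in> bracket_span n" "k \<in> {1..n}"
  shows "na_bracket p (na_gen k) \<in> bracket_span n"
proof -
  obtain F where F: "\<And>i j. F i j \<in> poly_ring n" "na_cong n p (bracket_comb n F)"
    using assms(1) unfolding bracket_span_def by blast
  have term_in_span: "na_bracket (na_scale c (na_act_monom n (na_bracket (na_gen i) (na_gen j)) m))
      (na_gen k) \<in> bracket_span n"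
    if "i \<in> {1..n}" "j \<in> {1..n}" "Poly_Mapping.keys m \<subseteq> {1..n}" for i j m c
  proof (rule bracket_span_cong)
    let ?p = "na_bracket (na_gen i) (na_gen j)"
    show "na_cong n (na_bracket (na_scale c (na_act_monom n ?p m)) (na_gen k))
        (na_act n ?p (Poly_Mapping.single (m + Poly_Mapping.single k 1) c))"
      unfolding na_act_single na_bracket_scale_left
      by (intro na_cong_scale na_cong_sym[OF na_act_monom_Suc] nonassoc_gen that assms(2))
    show "na_act n ?p (Poly_Mapping.single (m + Poly_Mapping.single k 1) c) \<in> bracket_span n"
      using that assms(2) Poly_Mapping.keys_add[of m "Poly_Mapping.single k 1"]
      by (intro na_act_in_bracket_span poly_ring_single) auto
  qed
  have "na_bracket (bracket_comb n F) (na_gen k) \<in> bracket_span n"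
    unfolding bracket_comb_def na_act_def na_bracket_sum_left
    using F(1) by (intro bracket_span_sum term_in_span) (auto simp: poly_ring_def)
  moreover have "na_cong n (na_bracket p (na_gen k)) (na_bracket (bracket_comb n F) (na_gen k))"
    by (intro na_cong_bracket F(2) na_cong_refl nonassoc_bracket_comb nonassoc_gen assms(2))
  ultimately show ?thesis by (rule bracket_span_cong[rotated])
qed

text \<open>Right multiplication by a generator maps this set into the bracket span, which drives the induction
  on words below.  In the end the set is the whole algebra on \<open>x_1, \<dots>, x_n\<close>.\<close>

definition full_span :: "nat \<Rightarrow> 'k::field nap set" where
  "full_span n = {p. \<exists>a. p - (\<Sum>i\<in>{1..n}. na_scale (a i) (na_gen i)) \<in> bracket_span n}"

lemma bracket_span_subset_full_span: "p \<in> bracket_span n \<Longrightarrow> p \<in> full_span n"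
  unfolding full_span_def by (auto intro!: exI[of _ "\<lambda>i. 0"])

lemma full_span_add:
  assumes "p \<in> full_span n" "q \<in> full_span n"
  shows "p + q \<in> full_span n"
proof -
  obtain a b where "p - (\<Sum>i\<in>{1..n}. na_scale (a i) (na_gen i)) \<in> bracket_span n"
    and "q - (\<Sum>i\<in>{1..n}. na_scale (b i) (na_gen i)) \<in> bracket_span n"
    using assms unfolding full_span_def by blast
  from bracket_span_add[OF this] show ?thesis
    unfolding full_span_def
    by (auto intro!: exI[of _ "\<lambda>i. a i + b i"] simp: na_scale_add_left sum.distrib algebra_simps)
qed

text \<open>The Leibniz identity in the form \<open>[p, [a, b]] = [[p, a], b] - [[p, b], a]\<close> makes right
  multiplication by a word an expression in right multiplications by shorter words, and in the end
  by generators.  The element \<open>p\<close> has to be arbitrary in the induction, since it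
  grows while the word shrinks.\<close>

lemma full_span_bracket_word:
  assumes "letters v \<subseteq> {1..n}" "p \<in> full_span n" "p \<in> nonassoc n"
  shows "na_bracket p (Poly_Mapping.single v 1) \<in> bracket_span n"
  using assms
proof (induction v arbitrary: p)
  case (Gen k)
  then have k: "k \<in> {1..n}" by simp
  obtain a where a: "p - (\<Sum>i\<in>{1..n}. na_scale (a i) (na_gen i)) \<in> bracket_span n" (is "?q \<in> _")
    using Gen.prems unfolding full_span_def by blast
  have "na_bracket p (na_gen k)
      = na_bracket ?q (na_gen k) + (\<Sum>i\<in>{1..n}. na_scale (a i) (na_bracket (na_gen i) (na_gen k)))"
    by (simp add: na_bracket_diff_left na_bracket_sum_left na_bracket_scale_left)
  then show ?case
    by (simp only:, intro bracket_span_add bracket_span_bracket_gen[OF a k] bracket_span_sum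
        bracket_span_scale_bracket_gens k)
next
  case (Br a b)
  let ?a = "Poly_Mapping.single a 1" and ?b = "Poly_Mapping.single b 1"
  have ab: "letters a \<subseteq> {1..n}" "letters b \<subseteq> {1..n}" using Br.prems by auto
  then have car: "?a \<in> nonassoc n" "?b \<in> nonassoc n" by (blast intro: nonassoc_single)+
  have "na_bracket (na_bracket p ?a) ?b \<in> bracket_span n" "na_bracket (na_bracket p ?b) ?a \<in> bracket_span n"
    using Br.IH ab car Br.prems bracket_span_subset_full_span nonassoc_bracket by meson+
  then have "na_bracket (na_bracket p ?a) ?b - na_bracket (na_bracket p ?b) ?a \<in> bracket_span n"
    by (rule bracket_span_diff)
  moreover have "na_cong n (na_bracket p (na_bracket ?a ?b))
      (na_bracket (na_bracket p ?a) ?b - na_bracket (na_bracket p ?b) ?a)"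
    using na_cong_sym[OF met_leib_ideal.leibniz[OF Br.prems(3) car]]
      met_leib_ideal.leibniz[OF Br.prems(3) car] ideal_minus by (fastforce simp: algebra_simps)
  ultimately show ?case
    using bracket_span_cong by (fastforce simp: na_bracket_single)
qed

lemma word_in_full_span: "letters w \<subseteq> {1..n} \<Longrightarrow> Poly_Mapping.single w c \<in> full_span n"
proof (induction w arbitrary: c)
  case (Gen k)
  have "na_scale (if i = k then c else 0) (na_gen i)
      = (if i = k then Poly_Mapping.single (Gen k) c else 0)" for i
    by (simp add: na_scale_single)
  then have "(\<Sum>i\<in>{1..n}. na_scale (if i = k then c else 0) (na_gen i))
      = Poly_Mapping.single (Gen k) c"
    using Gen by simp
  then show ?case
    unfolding full_span_def using bracket_span_0
    by (auto intro!: exI[of _ "\<lambda>i. if i = k then c else 0"])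
next
  case (Br u v)
  then have "na_bracket (Poly_Mapping.single u c) (Poly_Mapping.single v 1) \<in> bracket_span n"
    by (intro full_span_bracket_word nonassoc_single) auto
  then show ?case by (simp add: na_bracket_single bracket_span_subset_full_span)
qed

lemma normal_form_exists:
  assumes "p \<in> nonassoc n"
  shows "\<exists>a F. (\<forall>i j. F i j \<in> poly_ring n)
    \<and> na_cong n p ((\<Sum>i\<in>{1..n}. na_scale (a i) (na_gen i)) + bracket_comb n F)"
proof -
  have "(\<Sum>w\<in>Poly_Mapping.keys p. Poly_Mapping.single w (Poly_Mapping.lookup p w)) \<in> full_span n"
  proof (rule sum_in_additive)
    fix w assume "w \<in> Poly_Mapping.keys p"
    then show "Poly_Mapping.single w (Poly_Mapping.lookup p w) \<in> full_span n"
      using assms unfolding nonassoc_iff by (intro word_in_full_span) blast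
  qed (auto intro: bracket_span_subset_full_span bracket_span_0 full_span_add)
  then have "p \<in> full_span n" by (simp only: sum_singles)
  then obtain a F where "\<And>i j. F i j \<in> poly_ring n"
    "na_cong n (p - (\<Sum>i\<in>{1..n}. na_scale (a i) (na_gen i))) (bracket_comb n F)"
    unfolding full_span_def bracket_span_def by blast
  then show ?thesis
    by (intro exI[of _ a] exI[of _ F]) (simp add: algebra_simps)
qed

section \<open>Averaging over the symmetric group\<close>

text \<open>The term with indices \<open>(i, j)\<close> is moved to \<open>(\<sigma> i, \<sigma> j)\<close>; the inverse of \<open>\<sigma>\<close> comes from
  reading off the coefficients at the new places.\<close>

lemma na_perm_bracket_comb:
  assumes \<sigma>: "\<sigma> permutes {1..n}" and F: "\<And>i j. F i j \<in> poly_ring n"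
  shows "na_cong n (na_perm \<sigma> (bracket_comb n F))
    (bracket_comb n (\<lambda>i j. poly_perm \<sigma> (F (Hilbert_Choice.inv \<sigma> i) (Hilbert_Choice.inv \<sigma> j))))"
proof -
  define g where "g = (\<lambda>i j. na_act n (na_bracket (na_gen i) (na_gen j))
    (poly_perm \<sigma> (F (Hilbert_Choice.inv \<sigma> i) (Hilbert_Choice.inv \<sigma> j))))"
  have inv: "Hilbert_Choice.inv \<sigma> (\<sigma> i) = i" for i
    using permutes_inverses(2)[OF \<sigma>] by simp
  have "na_cong n (na_perm \<sigma> (na_act n (na_bracket (na_gen i) (na_gen j)) (F i j)))
      (g (\<sigma> i) (\<sigma> j))" if "i \<in> {1..n}" "j \<in> {1..n}" for i j
    using na_perm_act[OF \<sigma> nonassoc_gen[OF that(1)] nonassoc_gen[OF that(2)] F[of i j]]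
    by (simp add: g_def inv na_perm_single)
  then have "na_cong n (na_perm \<sigma> (bracket_comb n F))
      (\<Sum>i\<in>{1..n}. \<Sum>j\<in>{1..n}. g (\<sigma> i) (\<sigma> j))"
    unfolding bracket_comb_def na_perm_sum by (intro na_cong_sum)
  moreover have "(\<Sum>i\<in>{1..n}. \<Sum>j\<in>{1..n}. g (\<sigma> i) (\<sigma> j)) = (\<Sum>i\<in>{1..n}. \<Sum>j\<in>{1..n}. g i j)"
  proof -
    have "(\<Sum>j\<in>{1..n}. g i (\<sigma> j)) = (\<Sum>j\<in>{1..n}. g i j)" for i
      using sum.permute[OF \<sigma>, of "g i"] by (simp add: comp_def)
    then show ?thesis
      using sum.permute[OF \<sigma>, of "\<lambda>i. \<Sum>j\<in>{1..n}. g i j"] by (simp add: comp_def)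
  qed
  ultimately show ?thesis by (simp only: g_def bracket_comb_def)
qed

lemma na_perm_linear:
  assumes \<sigma>: "\<sigma> permutes {1..n}"
  shows "na_perm \<sigma> (\<Sum>i\<in>{1..n}. na_scale (a i) (na_gen i))
    = (\<Sum>i\<in>{1..n}. na_scale (a (Hilbert_Choice.inv \<sigma> i)) (na_gen i))"
proof -
  have "Hilbert_Choice.inv \<sigma> (\<sigma> i) = i" for i
    using permutes_inverses(2)[OF \<sigma>] by simp
  then show ?thesis
    using sum.permute[OF \<sigma>, of "\<lambda>i. na_scale (a (Hilbert_Choice.inv \<sigma> i)) (na_gen i)"]
    by (simp add: comp_def na_perm_sum na_perm_scale na_perm_single)
qed

text \<open>Substituting \<open>\<tau> \<circ> \<sigma>\<close> for \<open>\<sigma>\<close>: this is why the averaged coefficients are permuted by \<open>\<tau>\<close>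
  like their indices.\<close>

lemma sum_over_permutations_equivariant:
  assumes \<tau>: "\<tau> permutes S"
  shows "(\<Sum>\<sigma> | \<sigma> permutes S. \<phi> (\<tau> \<circ> \<sigma>) (Hilbert_Choice.inv \<sigma> i) (Hilbert_Choice.inv \<sigma> j))
    = (\<Sum>\<sigma> | \<sigma> permutes S. \<phi> \<sigma> (Hilbert_Choice.inv \<sigma> (\<tau> i)) (Hilbert_Choice.inv \<sigma> (\<tau> j)))"
proof -
  have "Hilbert_Choice.inv (\<tau> \<circ> \<sigma>) (\<tau> k) = Hilbert_Choice.inv \<sigma> k" if "\<sigma> permutes S" for \<sigma> k
    using permutes_inverses(2)[OF \<tau>] permutes_bij[OF \<tau>] permutes_bij[OF that]
    by (simp add: o_inv_distrib)
  then show ?thesis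
    by (subst (2) setum_permutations_compose_left[OF \<tau>]) (auto intro!: sum.cong)
qed

text \<open>The averaging argument.  An invariant \<open>p\<close> is the sum of the \<open>n!\<close> translates of \<open>p / n!\<close>, up to
  congruence.  Adding up the translates of one normal form of
  \<open>p / n!\<close> gives a normal form of \<open>p\<close> whose coefficients are sums over the whole group, hence
  equivariant.\<close>

lemma symmetric_normal_form_exists:
  fixes p :: "'k::field_char_0 nap"
  assumes p: "p \<in> nonassoc n" and invariant: "\<And>\<sigma>. \<sigma> permutes {1..n} \<Longrightarrow> na_cong n (na_perm \<sigma> p) p"
  shows "\<exists>\<alpha> G. (\<forall>i j. G i j \<in> poly_ring n)
    \<and> (\<forall>\<tau> i j. \<tau> permutes {1..n} \<longrightarrow> poly_perm \<tau> (G i j) = G (\<tau> i) (\<tau> j))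
    \<and> na_cong n p ((\<Sum>i\<in>{1..n}. na_scale \<alpha> (na_gen i)) + bracket_comb n G)"
proof -
  let ?P = "{\<sigma>. \<sigma> permutes {1..n}}"
  define q where "q = na_scale (1 / fact n) p"
  have "q \<in> nonassoc n" unfolding q_def using p by (rule nonassoc_scale)
  then obtain a F where F: "\<And>i j. F i j \<in> poly_ring n"
    and q: "na_cong n q ((\<Sum>i\<in>{1..n}. na_scale (a i) (na_gen i)) + bracket_comb n F)"
    using normal_form_exists by blast
  define A where "A i = (\<Sum>\<sigma>\<in>?P. a (Hilbert_Choice.inv \<sigma> i))" for i
  define G where "G i j = (\<Sum>\<sigma>\<in>?P. poly_perm \<sigma> (F (Hilbert_Choice.inv \<sigma> i) (Hilbert_Choice.inv \<sigma> j)))" for i j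
  have "card ?P = fact n" by (rule card_permutations) auto
  then have "p = (\<Sum>\<sigma>\<in>?P. q)"
    unfolding q_def na_scale_sum_left[symmetric]
    by (intro poly_mapping_eqI) simp
  moreover have "na_cong n (\<Sum>\<sigma>\<in>?P. q) (\<Sum>\<sigma>\<in>?P. (\<Sum>i\<in>{1..n}. na_scale (a (Hilbert_Choice.inv \<sigma> i)) (na_gen i))
      + bracket_comb n (\<lambda>i j. poly_perm \<sigma> (F (Hilbert_Choice.inv \<sigma> i) (Hilbert_Choice.inv \<sigma> j))))"
  proof (rule na_cong_sum)
    fix \<sigma> assume "\<sigma> \<in> ?P"
    then have \<sigma>: "\<sigma> permutes {1..n}" by simp
    have "na_cong n q (na_perm \<sigma> q)"
      unfolding q_def na_perm_scale by (rule na_cong_scale[OF na_cong_sym[OF invariant[OF \<sigma>]]])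
    moreover have "na_cong n (na_perm \<sigma> q)
        ((\<Sum>i\<in>{1..n}. na_scale (a (Hilbert_Choice.inv \<sigma> i)) (na_gen i)) + na_perm \<sigma> (bracket_comb n F))"
      using na_cong_perm[OF \<sigma> q] by (simp only: na_perm_add na_perm_linear[OF \<sigma>])
    moreover have "na_cong n
        ((\<Sum>i\<in>{1..n}. na_scale (a (Hilbert_Choice.inv \<sigma> i)) (na_gen i)) + na_perm \<sigma> (bracket_comb n F))
        ((\<Sum>i\<in>{1..n}. na_scale (a (Hilbert_Choice.inv \<sigma> i)) (na_gen i))
          + bracket_comb n (\<lambda>i j. poly_perm \<sigma> (F (Hilbert_Choice.inv \<sigma> i) (Hilbert_Choice.inv \<sigma> j))))"
      by (rule na_cong_add[OF na_cong_refl na_perm_bracket_comb[OF \<sigma> F]])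
    ultimately show "na_cong n q ((\<Sum>i\<in>{1..n}. na_scale (a (Hilbert_Choice.inv \<sigma> i)) (na_gen i))
        + bracket_comb n (\<lambda>i j. poly_perm \<sigma> (F (Hilbert_Choice.inv \<sigma> i) (Hilbert_Choice.inv \<sigma> j))))"
      by (rule na_cong_trans[OF na_cong_trans])
  qed
  moreover have "(\<Sum>\<sigma>\<in>?P. (\<Sum>i\<in>{1..n}. na_scale (a (Hilbert_Choice.inv \<sigma> i)) (na_gen i))
      + bracket_comb n (\<lambda>i j. poly_perm \<sigma> (F (Hilbert_Choice.inv \<sigma> i) (Hilbert_Choice.inv \<sigma> j))))
      = (\<Sum>i\<in>{1..n}. na_scale (A i) (na_gen i)) + bracket_comb n G"
  proof -
    have "(\<Sum>\<sigma>\<in>?P. \<Sum>i\<in>{1..n}. na_scale (a (Hilbert_Choice.inv \<sigma> i)) (na_gen i))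
        = (\<Sum>i\<in>{1..n}. na_scale (A i) (na_gen i))"
      unfolding A_def na_scale_sum_left by (rule sum.swap)
    moreover have "(\<Sum>\<sigma>\<in>?P. bracket_comb n (\<lambda>i j. poly_perm \<sigma> (F (Hilbert_Choice.inv \<sigma> i) (Hilbert_Choice.inv \<sigma> j))))
        = bracket_comb n G"
      unfolding bracket_comb_def G_def na_act_sum
      by (subst sum.swap, rule sum.cong[OF refl], rule sum.swap)
    ultimately show ?thesis by (simp only: sum.distrib)
  qed
  ultimately have p_cong: "na_cong n p ((\<Sum>i\<in>{1..n}. na_scale (A i) (na_gen i)) + bracket_comb n G)"
    by (simp only:)
  \<comment> \<open>The symmetric group is transitive on the indices, so the linear coefficients agree.\<close>
  have "A i = A 1" if "i \<in> {1..n}" for i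
  proof -
    have "transpose 1 i permutes {1..n}" using that by (intro permutes_swap_id) auto
    from sum_over_permutations_equivariant[OF this, of "\<lambda>\<sigma> i j. a i" 1 1]
    show ?thesis by (simp add: A_def)
  qed
  then have "(\<Sum>i\<in>{1..n}. na_scale (A i) (na_gen i)) = (\<Sum>i\<in>{1..n}. na_scale (A 1) (na_gen i))"
    by (metis (no_types, lifting) sum.cong)
  then have "na_cong n p ((\<Sum>i\<in>{1..n}. na_scale (A 1) (na_gen i)) + bracket_comb n G)"
    using p_cong by (simp only:)
  moreover have "G i j \<in> poly_ring n" for i j
    unfolding G_def by (intro poly_ring_sum poly_ring_perm F) simp
  moreover have "poly_perm \<tau> (G i j) = G (\<tau> i) (\<tau> j)" if "\<tau> permutes {1..n}" for \<tau> i j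
    unfolding G_def poly_perm_sum poly_perm_comp
    by (rule sum_over_permutations_equivariant[OF that, of "\<lambda>\<sigma> i j. poly_perm \<sigma> (F i j)"])
  ultimately show ?thesis
    by (intro exI[of _ "A 1"] exI[of _ G]) simp
qed

section \<open>The form of a symmetric element\<close>

text \<open>The index pairs are sorted by whether they are diagonal and by which of \<open>1\<close>, \<open>2\<close> occur in them,
  and where.\<close>

lemma double_sum_split:
  fixes t :: "nat \<Rightarrow> nat \<Rightarrow> 'a::comm_monoid_add"
  assumes "n \<ge> 2"
  shows "(\<Sum>i\<in>{1..n}. \<Sum>j\<in>{1..n}. t i j) =
    (\<Sum>i\<in>{1..n}. t i i) + (\<Sum>i\<in>{3..n}. \<Sum>j\<in>{3..n} - {i}. t i j) + t 1 2
    + (\<Sum>i\<in>{3..n}. t 1 i + t i 2) + t 2 1 + (\<Sum>i\<in>{3..n}. t i 1 + t 2 i)"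
proof -
  have S: "{1..n} = insert 1 (insert 2 {3..n})" using assms by auto
  have "(\<Sum>i\<in>{3..n}. \<Sum>j\<in>{3..n}. t i j) = (\<Sum>i\<in>{3..n}. t i i + (\<Sum>j\<in>{3..n} - {i}. t i j))"
    by (intro sum.cong refl sum.remove) auto
  then show ?thesis
    unfolding S by (simp add: sum.distrib ac_simps)
qed

theorem corollary2p3:
  fixes n :: nat and s :: "'k::field_char_0 nap set"
  assumes "n \<ge> 2" and "symmetric n s"
  shows "\<exists>(\<alpha>::'k) f g h.
    f \<in> poly_ring n \<and> g \<in> poly_ring n \<and> h \<in> poly_ring n \<and>
    (\<forall>\<pi>\<in>Pi1 n. poly_perm \<pi> f = f) \<and>
    (\<forall>\<sigma>\<in>Pi12 n. poly_perm \<sigma> g = g) \<and>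
    h = poly_perm (transpose 1 2) g \<and>
    s = (\<Oplus>\<^bsub>L n\<^esub>i\<in>{1..n}. \<alpha> \<odot>\<^bsub>L n\<^esub> gen n i)
      \<oplus>\<^bsub>L n\<^esub> (\<Oplus>\<^bsub>L n\<^esub>i\<in>{1..n}. gen_bracket n i i \<bullet>\<^bsub>n\<^esub> poly_perm (transpose 1 i) f)
      \<oplus>\<^bsub>L n\<^esub> (\<Oplus>\<^bsub>L n\<^esub>i\<in>{3..n}. \<Oplus>\<^bsub>L n\<^esub>j\<in>{3..n} - {i}.
            gen_bracket n i j \<bullet>\<^bsub>n\<^esub> poly_perm (transpose 1 i \<circ> transpose 2 j) g)
      \<oplus>\<^bsub>L n\<^esub> gen_bracket n 1 2 \<bullet>\<^bsub>n\<^esub> g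
      \<oplus>\<^bsub>L n\<^esub> (\<Oplus>\<^bsub>L n\<^esub>i\<in>{3..n}.
            gen_bracket n 1 i \<bullet>\<^bsub>n\<^esub> poly_perm (transpose 2 i) g
            \<oplus>\<^bsub>L n\<^esub> gen_bracket n i 2 \<bullet>\<^bsub>n\<^esub> poly_perm (transpose 1 i) g)
      \<oplus>\<^bsub>L n\<^esub> gen_bracket n 2 1 \<bullet>\<^bsub>n\<^esub> h
      \<oplus>\<^bsub>L n\<^esub> (\<Oplus>\<^bsub>L n\<^esub>i\<in>{3..n}.
            gen_bracket n i 1 \<bullet>\<^bsub>n\<^esub> poly_perm (transpose 2 i) h
            \<oplus>\<^bsub>L n\<^esub> gen_bracket n 2 i \<bullet>\<^bsub>n\<^esub> poly_perm (transpose 1 i) h)"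
proof -
  obtain p where p: "p \<in> nonassoc n" "s = cls n p"
    using assms(2) unfolding symmetric_def carrier_L by blast
  have "na_cong n (na_perm \<sigma> p) p" if "\<sigma> permutes {1..n}" for \<sigma>
  proof -
    have "na_perm \<sigma> ` cls n p = cls n p"
      using assms(2) that unfolding symmetric_def L_perm_def p(2) by blast
    then show ?thesis using self_mem_cls[of p n] unfolding mem_cls_iff[symmetric] by blast
  qed
  from symmetric_normal_form_exists[OF p(1) this]
  obtain \<alpha> G where G: "\<And>i j. G i j \<in> poly_ring n"
    and equiv: "\<And>\<tau> i j. \<tau> permutes {1..n} \<Longrightarrow> poly_perm \<tau> (G i j) = G (\<tau> i) (\<tau> j)"
    and p_cong: "na_cong n p ((\<Sum>i\<in>{1..n}. na_scale \<alpha> (na_gen i)) + bracket_comb n G)"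
    by blast
  define f g h where "f = G 1 1" and "g = G 1 2" and "h = poly_perm (transpose 1 2) g"
  have tr: "transpose a b permutes {1..n}" if "a \<in> {1..n}" "b \<in> {1..n}" for a b
    using that by (rule permutes_swap_id)
  \<comment> \<open>By equivariance each coefficient of the theorem is some \<open>G i j\<close>: the permutation in front of
    \<open>f\<close>, \<open>g\<close> or \<open>h\<close> maps the index pair \<open>(1, 1)\<close>, \<open>(1, 2)\<close> or \<open>(2, 1)\<close> to \<open>(i, j)\<close>.\<close>
  have h: "h = G 2 1"
    unfolding h_def g_def using assms(1) by (subst equiv[OF tr]) auto
  define t where "t i j = na_act n (na_bracket (na_gen i) (na_gen j)) (G i j)" for i j
  have t_in: "t i j \<in> nonassoc n" if "i \<in> {1..n}" "j \<in> {1..n}" for i j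
    unfolding t_def by (intro nonassoc_act nonassoc_bracket nonassoc_gen that)
  have t: "gen_bracket n i j \<bullet>\<^bsub>n\<^esub> e = cls n (t i j)"
    if "i \<in> {1..n}" "j \<in> {1..n}" "e = G i j" for i j e
    unfolding t_def that(3) gen_eq_cls L_mult_cls[OF that(1,2)[THEN nonassoc_gen]]
    by (intro act_cls nonassoc_bracket nonassoc_gen that)
  have lin: "(\<Oplus>\<^bsub>L n\<^esub>i\<in>{1..n}. \<alpha> \<odot>\<^bsub>L n\<^esub> gen n i) = cls n (\<Sum>i\<in>{1..n}. na_scale \<alpha> (na_gen i))"
    by (rule L_finsum_cls) (auto simp only: gen_eq_cls L_smult_cls finite_atLeastAtMost
        intro!: nonassoc_scale nonassoc_gen)
  have diag: "(\<Oplus>\<^bsub>L n\<^esub>i\<in>{1..n}. gen_bracket n i i \<bullet>\<^bsub>n\<^esub> poly_perm (transpose 1 i) f)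
      = cls n (\<Sum>i\<in>{1..n}. t i i)"
    using assms(1) by (intro L_finsum_cls t t_in) (auto simp: f_def equiv[OF tr])
  have off: "(\<Oplus>\<^bsub>L n\<^esub>i\<in>{3..n}. \<Oplus>\<^bsub>L n\<^esub>j\<in>{3..n} - {i}.
        gen_bracket n i j \<bullet>\<^bsub>n\<^esub> poly_perm (transpose 1 i \<circ> transpose 2 j) g)
      = cls n (\<Sum>i\<in>{3..n}. \<Sum>j\<in>{3..n} - {i}. t i j)"
    using assms(1) by (intro L_finsum_cls t t_in nonassoc_sum)
      (auto simp: g_def equiv[OF permutes_compose[OF tr tr]])
  have row1: "(\<Oplus>\<^bsub>L n\<^esub>i\<in>{3..n}.
        gen_bracket n 1 i \<bullet>\<^bsub>n\<^esub> poly_perm (transpose 2 i) g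
        \<oplus>\<^bsub>L n\<^esub> gen_bracket n i 2 \<bullet>\<^bsub>n\<^esub> poly_perm (transpose 1 i) g)
      = cls n (\<Sum>i\<in>{3..n}. t 1 i + t i 2)"
  proof (rule L_finsum_cls)
    fix i assume i: "i \<in> {3..n}"
    then have "gen_bracket n 1 i \<bullet>\<^bsub>n\<^esub> poly_perm (transpose 2 i) g = cls n (t 1 i)"
      and "gen_bracket n i 2 \<bullet>\<^bsub>n\<^esub> poly_perm (transpose 1 i) g = cls n (t i 2)"
      using assms(1) by (intro t; auto simp: g_def equiv[OF tr])+
    then show "gen_bracket n 1 i \<bullet>\<^bsub>n\<^esub> poly_perm (transpose 2 i) g
        \<oplus>\<^bsub>L n\<^esub> gen_bracket n i 2 \<bullet>\<^bsub>n\<^esub> poly_perm (transpose 1 i) g = cls n (t 1 i + t i 2)"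
      by (simp only: L_add_cls)
    show "t 1 i + t i 2 \<in> nonassoc n"
      using i by (intro nonassoc_add t_in) auto
  qed simp
  have row2: "(\<Oplus>\<^bsub>L n\<^esub>i\<in>{3..n}.
        gen_bracket n i 1 \<bullet>\<^bsub>n\<^esub> poly_perm (transpose 2 i) h
        \<oplus>\<^bsub>L n\<^esub> gen_bracket n 2 i \<bullet>\<^bsub>n\<^esub> poly_perm (transpose 1 i) h)
      = cls n (\<Sum>i\<in>{3..n}. t i 1 + t 2 i)"
  proof (rule L_finsum_cls)
    fix i assume i: "i \<in> {3..n}"
    then have "gen_bracket n i 1 \<bullet>\<^bsub>n\<^esub> poly_perm (transpose 2 i) h = cls n (t i 1)"
      and "gen_bracket n 2 i \<bullet>\<^bsub>n\<^esub> poly_perm (transpose 1 i) h = cls n (t 2 i)"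
      using assms(1) by (intro t; auto simp: h equiv[OF tr])+
    then show "gen_bracket n i 1 \<bullet>\<^bsub>n\<^esub> poly_perm (transpose 2 i) h
        \<oplus>\<^bsub>L n\<^esub> gen_bracket n 2 i \<bullet>\<^bsub>n\<^esub> poly_perm (transpose 1 i) h = cls n (t i 1 + t 2 i)"
      by (simp only: L_add_cls)
    show "t i 1 + t 2 i \<in> nonassoc n"
      using i by (intro nonassoc_add t_in) auto
  qed simp
  have t12: "gen_bracket n 1 2 \<bullet>\<^bsub>n\<^esub> g = cls n (t 1 2)"
    and t21: "gen_bracket n 2 1 \<bullet>\<^bsub>n\<^esub> h = cls n (t 2 1)"
    using assms(1) by (intro t; simp add: g_def h)+
  have "s = cls n ((\<Sum>i\<in>{1..n}. na_scale \<alpha> (na_gen i)) + (\<Sum>i\<in>{1..n}. \<Sum>j\<in>{1..n}. t i j))"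
    using p_cong unfolding p(2) cls_eq_iff bracket_comb_def t_def .
  then have s: "s = cls n ((\<Sum>i\<in>{1..n}. na_scale \<alpha> (na_gen i)) + (\<Sum>i\<in>{1..n}. t i i)
      + (\<Sum>i\<in>{3..n}. \<Sum>j\<in>{3..n} - {i}. t i j) + t 1 2
      + (\<Sum>i\<in>{3..n}. t 1 i + t i 2) + t 2 1 + (\<Sum>i\<in>{3..n}. t i 1 + t 2 i))"
    unfolding double_sum_split[OF assms(1)] by (simp only: add.assoc)
  show ?thesis
  proof (rule exI[of _ \<alpha>], rule exI[of _ f], rule exI[of _ g], rule exI[of _ h], intro conjI)
    show "f \<in> poly_ring n" "g \<in> poly_ring n" "h \<in> poly_ring n"
      by (simp_all only: f_def g_def h G)
    show "\<forall>\<pi>\<in>Pi1 n. poly_perm \<pi> f = f" "\<forall>\<sigma>\<in>Pi12 n. poly_perm \<sigma> g = g"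
      by (auto simp: Pi1_def Pi12_def f_def g_def equiv)
    show "h = poly_perm (transpose 1 2) g" by (rule h_def)
  qed (simp only: lin diag off row1 row2 t12 t21 L_add_cls s)
qed

end
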